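(* There exists a constant $\alpha>0$ such that for all sufficiently large $X$, \[ \#\{1\leq n\leq X:\ \sigma moex(n)\text{ is even}\}\geq \alpha\log\log X . \]
   Context: For a partition $\pi$ of a positive integer $n$, $moex(\pi)$ is the smallest odd positive integer that is not a part of $\pi$. For a positive integer $n$, $\sigma moex(n)=\sum_{\pi} moex(\pi)$, summed over all partitions $\pi$ of $n$, and $\sigma moex(0)=1$. Equivalently, $\sum_{n\geq 0}\sigma moex(n)q^n=(-q;q)_\infty(-q;q^2)_\infty^2$, where $(a;q)_\infty=\prod_{m\geq 1}(1-aq^{m-1})$. *)

theory Defs
  imports Complex_Main "HOL-Library.Multiset"
begin

definition partitions_of :: "nat \<Rightarrow> nat multiset set" where
  "partitions_of n = {\<pi>. 0 \<notin># \<pi> \<and> sum_mset \<pi> = n}"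

definition moex :: "nat multiset \<Rightarrow> nat" where
  "moex \<pi> = (LEAST k. odd k \<and> k \<notin># \<pi>)"

definition sigma_moex :: "nat \<Rightarrow> nat" where
  "sigma_moex n = (if n = 0 then 1 else \<Sum>\<pi>\<in>partitions_of n. moex \<pi>)"

lemma size_le_sum_mset:
  fixes \<pi> :: "nat multiset"
  assumes "0 \<notin># \<pi>"
  shows "size \<pi> \<le> sum_mset \<pi>"
  using assms by (induction \<pi>) auto

text \<open>The sum in \<^const>\<open>sigma_moex\<close> is a genuine finite sum.\<close>

lemma finite_partitions_of: "finite (partitions_of n)"
proof (rule finite_subset)
  show "partitions_of n \<subseteq> mset ` {xs. set xs \<subseteq> {..n} \<and> length xs \<le> n}"
  proof
    fix \<pi> assume "\<pi> \<in> partitions_of n"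
    then have p: "0 \<notin># \<pi>" "sum_mset \<pi> = n"
      by (auto simp: partitions_of_def)
    obtain xs where xs: "mset xs = \<pi>"
      using ex_mset by blast
    have "length xs \<le> n"
      using size_le_sum_mset[OF p(1)] p(2) xs by (metis size_mset)
    moreover have "set xs \<subseteq> {..n}"
      using p(2) xs by (auto simp: sum_mset_sum_list member_le_sum_list)
    ultimately show "\<pi> \<in> mset ` {xs. set xs \<subseteq> {..n} \<and> length xs \<le> n}"
      using xs by blast
  qed
  show "finite (mset ` {xs. set xs \<subseteq> {..n} \<and> length xs \<le> n})"
    by (intro finite_imageI finite_lists_length_le) simp
qed

end

theory Submission
  imports Defs
begin

text \<open>
  Since \<^const>\<open>moex\<close> only takes odd values, \<open>sigma_moex n\<close> has the parity of the number \<open>p n\<close> of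
  partitions of \<open>n\<close>. The Bressoud--Zeilberger involution shows that the sum of
  \<open>p (n - j (3 j + 1) / 2)\<close> over all integers \<open>j\<close> is even for \<open>n \<ge> 1\<close>. For
  \<open>n = m (3 m - 1) / 2 - 1\<close> this sum has \<open>2 m - 1\<close> nonzero terms, all of them with argument
  at least \<open>m\<close>, so (following Kolberg) \<open>p\<close> takes an even value between \<open>m\<close> and \<open>n\<close>. Applying this to
  \<open>m = 2 ^ 3 ^ i\<close> gives one even value in each of the intervals from \<open>2 ^ 3 ^ i\<close>
  to \<open>2 ^ 3 ^ Suc i\<close>.
\<close>

section \<open>Reduction to the parity of the number of partitions\<close>

text \<open>A multiset has finite support, so some odd number is missing from it and the
  \<open>LEAST\<close> in \<open>moex\<close> is attained.\<close>

lemma odd_moex: "odd (moex \<pi>)"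
proof -
  have "\<exists>k. odd k \<and> k \<notin># \<pi>"
  proof (rule ccontr)
    assume "\<nexists>k. odd k \<and> k \<notin># \<pi>"
    then have "Suc (2 * k) \<in># \<pi>" for k
      by (metis even_Suc dvd_triv_left)
    then have "range (\<lambda>k. Suc (2 * k)) \<subseteq> set_mset \<pi>"
      by blast
    then have "finite (range (\<lambda>k::nat. Suc (2 * k)))"
      using finite_subset by blast
    moreover have "inj (\<lambda>k::nat. Suc (2 * k))"
      by (simp add: inj_def)
    ultimately show False
      using finite_imageD by blast
  qed
  then show ?thesis
    unfolding moex_def by (rule LeastI2_ex) simp
qed

lemma even_sigma_moex_iff:
  assumes "n > 0"
  shows "even (sigma_moex n) \<longleftrightarrow> even (card (partitions_of n))"
proof -
  have "{\<pi> \<in> partitions_of n. odd (moex \<pi>)} = partitions_of n"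
    by (simp add: odd_moex)
  then show ?thesis
    using assms by (simp add: sigma_moex_def even_sum_iff finite_partitions_of)
qed

section \<open>Generalized pentagonal numbers and the Bressoud-Zeilberger maps\<close>

definition pent :: "int \<Rightarrow> int" where
  "pent j = j * (3 * j + 1) div 2"

lemma two_pent: "2 * pent j = j * (3 * j + 1)"
  unfolding pent_def by simp

lemma pent_pred: "pent (j - 1) = pent j - 3 * j + 1"
  using two_pent[of j] two_pent[of "j - 1"] by (simp add: algebra_simps)

lemma pent_succ: "pent (j + 1) = pent j + 3 * j + 2"
  using pent_pred[of "j + 1"] by simp

text \<open>Counting these pairs yields the pentagonal sum of partition numbers. The additive
  equation over the integers excludes every \<open>j\<close> with \<open>pent j > n\<close> by
  itself.\<close>

definition euler_pairs :: "nat \<Rightarrow> (int \<times> nat multiset) set" where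
  "euler_pairs n = {(j, \<pi>). 0 \<notin># \<pi> \<and> int (sum_mset \<pi>) + pent j = int n}"

definition top_part :: "nat multiset \<Rightarrow> nat" where
  "top_part \<pi> = Max (insert 0 (set_mset \<pi>))"

text \<open>Removal of the first column of the Ferrers diagram.\<close>

definition strip :: "nat multiset \<Rightarrow> nat multiset" where
  "strip \<pi> = filter_mset ((<) 0) (image_mset (\<lambda>x. x - 1) \<pi>)"

text \<open>Removing the first column costs \<open>size \<pi>\<close>, and the new part is
  \<open>size \<pi> + 3 * j - 1\<close>. So the sum grows by \<open>3 * j - 1\<close>, which is what
  \<open>pent\<close> loses from \<open>j\<close> to \<open>j - 1\<close>. The filter drops a new
  part 0.\<close>

definition bz_down :: "int \<times> nat multiset \<Rightarrow> int \<times> nat multiset" where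
  "bz_down = (\<lambda>(j, \<pi>). (j - 1,
     filter_mset ((<) 0) {#nat (int (size \<pi>) + 3 * j - 1)#} + strip \<pi>))"

text \<open>The empty partition is treated as a single part 0, hence the \<open>max\<close>.\<close>

definition bz_up :: "int \<times> nat multiset \<Rightarrow> int \<times> nat multiset" where
  "bz_up = (\<lambda>(j, \<pi>). (j + 1,
     image_mset Suc (\<pi> - {#top_part \<pi>#}) +
     replicate_mset (nat (int (top_part \<pi>) - int (max 1 (size \<pi>)) - 3 * j - 1)) 1))"

section \<open>Largest parts and removal of the first column\<close>

lemma top_part_le_iff: "top_part \<pi> \<le> m \<longleftrightarrow> (\<forall>x\<in>#\<pi>. x \<le> m)"
  by (simp add: top_part_def)

lemma top_part_empty [simp]: "top_part {#} = 0"
  by (simp add: top_part_def)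

lemma top_part_in: "\<pi> \<noteq> {#} \<Longrightarrow> top_part \<pi> \<in># \<pi>"
  by (simp add: top_part_def max_def)

lemma size_strip_le: "size (strip \<pi>) \<le> size \<pi>"
  unfolding strip_def by (metis size_filter_mset_lesseq size_image_mset)

lemma zero_notin_strip: "0 \<notin># strip \<pi>"
  by (simp add: strip_def)

lemma sum_strip: "0 \<notin># \<pi> \<Longrightarrow> sum_mset (strip \<pi>) + size \<pi> = sum_mset \<pi>"
  by (induction \<pi>) (auto simp: strip_def)

text \<open>The only parts lost in \<open>strip\<close> are the ones, so the drop in size says how
  many to put back.\<close>

lemma strip_restore:
  "0 \<notin># \<pi> \<Longrightarrow> image_mset Suc (strip \<pi>) + replicate_mset (size \<pi> - size (strip \<pi>)) 1 = \<pi>"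
proof (induction \<pi>)
  case (add x \<pi>)
  then show ?case
    using size_strip_le[of \<pi>] by (auto simp: strip_def Suc_diff_le)
qed (simp add: strip_def)

lemma strip_image_Suc:
  "0 \<notin># \<pi> \<Longrightarrow> strip (image_mset Suc \<pi> + replicate_mset c 1) = \<pi>"
  by (induction \<pi>) (auto simp: strip_def filter_mset_eq_conv)

lemma strip_eq_empty: "\<forall>x\<in>#\<pi>. x \<le> 1 \<Longrightarrow> strip \<pi> = {#}"
  by (auto simp: strip_def filter_mset_eq_conv)

lemma sum_image_Suc: "sum_mset (image_mset Suc \<pi>) = sum_mset \<pi> + size \<pi>"
  by (induction \<pi>) auto

section \<open>The two maps are mutually inverse\<close>

text \<open>The inserted part is at least as large as all stripped parts, so \<open>bz_up\<close>
  finds it again as the largest part. The inequality flips because the size grows by at most 1 while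
  \<open>3 * j\<close> drops by 3.\<close>

lemma bz_down_props:
  assumes "n > 0" "(j, \<pi>) \<in> euler_pairs n" "int (top_part \<pi>) \<le> int (size \<pi>) + 3 * j"
  obtains \<rho> where "bz_down (j, \<pi>) = (j - 1, \<rho>)" "(j - 1, \<rho>) \<in> euler_pairs n"
    "int (size \<rho>) + 3 * (j - 1) < int (top_part \<rho>)" "bz_up (j - 1, \<rho>) = (j, \<pi>)"
proof -
  define s where "s = nat (int (size \<pi>) + 3 * j)"
  have s: "int s = int (size \<pi>) + 3 * j"
    using assms(3) by (simp add: s_def)
  have \<pi>: "0 \<notin># \<pi>" "int (sum_mset \<pi>) + pent j = int n"
    using assms(2) by (auto simp: euler_pairs_def)
  have top: "\<forall>x\<in>#\<pi>. x \<le> s"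
    using assms(3) s by (simp flip: top_part_le_iff)
  \<comment> \<open>If \<open>s = 0\<close>, then \<open>\<pi>\<close> is empty and
    \<open>j = 0\<close>, hence \<open>n = 0\<close>. This pair has no partner.\<close>
  have "s > 0"
  proof (rule ccontr)
    assume "\<not> s > 0"
    then have "\<pi> = {#}"
      using top \<pi>(1) by (metis gr0I le_zero_eq multiset_nonemptyE)
    with s \<open>\<not> s > 0\<close> \<pi>(2) assms(1) show False
      by (simp add: pent_def)
  qed
  have strip_top: "\<forall>x\<in>#strip \<pi>. x \<le> s - 1"
    using top by (auto simp: strip_def)
  define \<rho> where "\<rho> = filter_mset ((<) 0) {#s - 1#} + strip \<pi>"
  have down: "bz_down (j, \<pi>) = (j - 1, \<rho>)"
    using s \<open>s > 0\<close> by (simp add: bz_down_def \<rho>_def nat_diff_distrib' flip: s)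
  have "sum_mset \<rho> = s - 1 + sum_mset (strip \<pi>)"
    by (simp add: \<rho>_def)
  then have mem: "(j - 1, \<rho>) \<in> euler_pairs n"
    using \<pi>(2) sum_strip[OF \<pi>(1)] s \<open>s > 0\<close> zero_notin_strip[of \<pi>]
    by (simp add: euler_pairs_def pent_pred del: of_nat_sum_mset) (simp add: \<rho>_def)
  show ?thesis
  \<comment> \<open>For \<open>s = 1\<close> the new part is 0 and is dropped, so
    \<open>\<rho>\<close> is empty and \<open>\<pi>\<close> consists of ones. Here
    \<open>bz_up\<close> relies on \<open>top_part {#} = 0\<close> and on counting this phantom part
    through \<open>max 1\<close>.\<close>
  proof (cases "s = 1")
    case True
    then have empty: "\<rho> = {#}" "strip \<pi> = {#}"
      using strip_eq_empty[of \<pi>] top by (auto simp: \<rho>_def)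
    have "replicate_mset (size \<pi>) 1 = \<pi>"
      using strip_restore[OF \<pi>(1)] empty by simp
    moreover have "nat (- 3 * (j - 1) - 2) = size \<pi>"
      using s True by simp
    ultimately have "bz_up (j - 1, \<rho>) = (j, \<pi>)"
      by (simp add: bz_up_def empty)
    moreover have "int (size \<rho>) + 3 * (j - 1) < int (top_part \<rho>)"
      using s True empty by simp
    ultimately show ?thesis
      using down mem that by blast
  next
    case False
    then have \<rho>: "\<rho> = add_mset (s - 1) (strip \<pi>)"
      using \<open>s > 0\<close> by (simp add: \<rho>_def)
    have top\<rho>: "top_part \<rho> = s - 1"
      using strip_top by (auto simp: \<rho> top_part_def intro!: Max_eqI)
    have "int (size \<rho>) + 3 * (j - 1) < int (top_part \<rho>)"
      using size_strip_le[of \<pi>] s \<open>s > 0\<close> unfolding top\<rho> by (simp add: \<rho>)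
    moreover have "nat (int (top_part \<rho>) - int (max 1 (size \<rho>)) - 3 * (j - 1) - 1)
        = size \<pi> - size (strip \<pi>)"
      unfolding top\<rho> using s \<open>s > 0\<close> size_strip_le[of \<pi>] by (simp add: \<rho>)
    then have "bz_up (j - 1, \<rho>) = (j, \<pi>)"
      using strip_restore[OF \<pi>(1)] unfolding bz_up_def by (simp add: top\<rho>) (simp add: \<rho>)
    ultimately show ?thesis
      using down mem that by blast
  qed
qed

text \<open>The number of added ones is chosen so that
  \<open>size \<rho> + 3 * (j + 1) = top_part \<pi> + 1\<close>. This yields the opposite inequality
  and makes \<open>bz_down\<close> reinsert exactly the removed part.\<close>

lemma bz_up_props:
  assumes "(j, \<pi>) \<in> euler_pairs n" "int (size \<pi>) + 3 * j < int (top_part \<pi>)"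
  obtains \<rho> where "bz_up (j, \<pi>) = (j + 1, \<rho>)" "(j + 1, \<rho>) \<in> euler_pairs n"
    "int (top_part \<rho>) \<le> int (size \<rho>) + 3 * (j + 1)" "bz_down (j + 1, \<rho>) = (j, \<pi>)"
proof -
  define c where "c = nat (int (top_part \<pi>) - int (max 1 (size \<pi>)) - 3 * j - 1)"
  define \<tau> where "\<tau> = \<pi> - {#top_part \<pi>#}"
  define \<rho> where "\<rho> = image_mset Suc \<tau> + replicate_mset c 1"
  have \<pi>: "0 \<notin># \<pi>" "int (sum_mset \<pi>) + pent j = int n"
    using assms(1) by (auto simp: euler_pairs_def)
  \<comment> \<open>The \<open>nat\<close> truncates nothing: for empty \<open>\<pi>\<close> the
    assumption forces \<open>j \<le> -1\<close>, so the value \<open>- 3 * j - 2\<close> is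
    positive.\<close>
  have c: "int c = int (top_part \<pi>) - int (max 1 (size \<pi>)) - 3 * j - 1"
    using assms(2) by (cases "\<pi> = {#}") (auto simp: c_def max_def Suc_le_eq)
  have restore: "filter_mset ((<) 0) {#top_part \<pi>#} + \<tau> = \<pi>"
  proof (cases "\<pi> = {#}")
    case False
    then show ?thesis
      using top_part_in[OF False] \<pi>(1) by (cases "top_part \<pi>") (auto simp: \<tau>_def)
  qed (simp add: \<tau>_def)
  have size: "int (size \<tau>) = int (max 1 (size \<pi>)) - 1"
  proof (cases "\<pi> = {#}")
    case False
    then have "size \<pi> = Suc (size \<tau>)"
      unfolding \<tau>_def using top_part_in[OF False] by (metis insert_DiffM size_add_mset)
    then show ?thesis by simp
  qed (simp add: \<tau>_def)
  have sum: "sum_mset \<pi> = top_part \<pi> + sum_mset \<tau>"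
    by (subst restore[symmetric]) simp
  have \<tau>: "0 \<notin># \<tau>" "\<forall>x\<in>#\<tau>. x \<le> top_part \<pi>"
    using \<pi>(1) by (auto simp: \<tau>_def top_part_def dest: in_diffD)
  have up: "bz_up (j, \<pi>) = (j + 1, \<rho>)"
    by (simp add: bz_up_def \<rho>_def c_def \<tau>_def)
  have size\<rho>: "int (size \<rho>) + 3 * (j + 1) = int (top_part \<pi>) + 1"
    using c size by (simp add: \<rho>_def)
  have "0 \<notin># \<rho>"
    by (auto simp: \<rho>_def)
  moreover have "int (sum_mset \<rho>) + pent (j + 1) = int n"
    using \<pi>(2) sum c size by (simp add: \<rho>_def sum_image_Suc pent_succ)
  ultimately have mem: "(j + 1, \<rho>) \<in> euler_pairs n"
    by (simp add: euler_pairs_def)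
  have "top_part \<rho> \<le> top_part \<pi> + 1"
    unfolding top_part_le_iff using \<tau>(2) by (auto simp: \<rho>_def)
  then have top: "int (top_part \<rho>) \<le> int (size \<rho>) + 3 * (j + 1)"
    unfolding size\<rho> by simp
  have "bz_down (j + 1, \<rho>) = (j, \<pi>)"
    unfolding bz_down_def prod.case size\<rho>
    using restore strip_image_Suc[OF \<tau>(1), of c] by (simp add: \<rho>_def)
  with up mem top that show ?thesis
    by blast
qed

section \<open>Parity of the pentagonal sum\<close>

lemma pent_nonneg: "pent j \<ge> 0"
proof -
  have "j * (3 * j + 1) \<ge> 0"
    by (cases "j \<ge> 0") (auto intro: mult_nonpos_nonpos)
  then show ?thesis
    using two_pent[of j] by linarith
qed

lemma abs_le_pent: "\<bar>j\<bar> \<le> pent j"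
proof -
  have "2 * \<bar>j\<bar> \<le> j * (3 * j + 1)"
  proof (cases "j = 0")
    case False
    then have "\<bar>j\<bar> * 1 \<le> \<bar>j\<bar> * \<bar>j\<bar>"
      by (intro mult_left_mono) auto
    then show ?thesis
      by (simp add: algebra_simps)
  qed simp
  then show ?thesis
    using two_pent[of j] by linarith
qed

lemma finite_pent_le: "finite {j. pent j \<le> m}"
proof (rule finite_subset)
  show "{j. pent j \<le> m} \<subseteq> {-m..m}"
  proof
    fix j assume "j \<in> {j. pent j \<le> m}"
    then show "j \<in> {-m..m}"
      using abs_le_pent[of j] by auto
  qed
qed simp

lemma euler_pairs_eq:
  "euler_pairs n = (SIGMA j:{j. pent j \<le> int n}. partitions_of (nat (int n - pent j)))"
  by (auto simp: euler_pairs_def partitions_of_def simp del: of_nat_sum_mset)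

text \<open>The inequality between \<open>top_part \<pi>\<close> and
  \<open>size \<pi> + 3 * j\<close> splits the pairs into two classes, which \<open>bz_down\<close>
  and \<open>bz_up\<close> match bijectively.\<close>

lemma even_card_euler_pairs:
  assumes "n > 0"
  shows "even (card (euler_pairs n))"
proof -
  define A where "A = {(j, \<pi>) \<in> euler_pairs n. int (top_part \<pi>) \<le> int (size \<pi>) + 3 * j}"
  define B where "B = {(j, \<pi>) \<in> euler_pairs n. int (size \<pi>) + 3 * j < int (top_part \<pi>)}"
  have down: "bz_up (bz_down x) = x \<and> bz_down x \<in> B" if x: "x \<in> A" for x
  proof -
    obtain j \<pi> where x_eq: "x = (j, \<pi>)"
      by (cases x)
    have "(j, \<pi>) \<in> euler_pairs n" "int (top_part \<pi>) \<le> int (size \<pi>) + 3 * j"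
      using x by (simp_all add: A_def x_eq)
    from bz_down_props[OF assms this] show ?thesis
      by (metis (mono_tags, lifting) B_def case_prodI mem_Collect_eq x_eq)
  qed
  have up: "bz_down (bz_up x) = x \<and> bz_up x \<in> A" if x: "x \<in> B" for x
  proof -
    obtain j \<pi> where x_eq: "x = (j, \<pi>)"
      by (cases x)
    have "(j, \<pi>) \<in> euler_pairs n" "int (size \<pi>) + 3 * j < int (top_part \<pi>)"
      using x by (simp_all add: B_def x_eq)
    from bz_up_props[OF this] show ?thesis
      by (metis (mono_tags, lifting) A_def case_prodI mem_Collect_eq x_eq)
  qed
  have "bij_betw bz_down A B"
    using down up by (intro bij_betw_byWitness[where f' = bz_up]) auto
  then have "card A = card B"
    by (rule bij_betw_same_card)
  moreover have "finite (euler_pairs n)"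
    unfolding euler_pairs_eq using finite_pent_le finite_partitions_of by blast
  moreover have "euler_pairs n = A \<union> B" "A \<inter> B = {}"
    by (auto simp: A_def B_def)
  ultimately have "card (euler_pairs n) = 2 * card B"
    by (metis card_Un_disjoint finite_Un mult_2)
  then show ?thesis by simp
qed

text \<open>Euler's pentagonal recurrence modulo 2, where its signs disappear.\<close>

theorem even_pentagonal_sum:
  assumes "n > 0"
  shows "even (\<Sum>j | pent j \<le> int n. card (partitions_of (nat (int n - pent j))))"
  using even_card_euler_pairs[OF assms]
  by (simp add: euler_pairs_eq finite_pent_le finite_partitions_of)

section \<open>Kolberg's argument for even partition numbers\<close>

text \<open>On \<open>\<bar>j\<bar> < m\<close> the largest value is
  \<open>pent (m - 1) = pent (- m) - (2 * m - 1)\<close>; on \<open>\<bar>j\<bar> \<ge> m\<close>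
  the least is \<open>pent (- m)\<close>.\<close>

lemma pent_neg_bounds:
  assumes "m > 0"
  shows "pent j < pent (- m) \<longleftrightarrow> \<bar>j\<bar> < m"
    and "\<bar>j\<bar> < m \<Longrightarrow> pent j + 2 * m - 1 \<le> pent (- m)"
proof -
  show gap: "pent j + 2 * m - 1 \<le> pent (- m)" if "\<bar>j\<bar> < m"
  proof -
    have "\<bar>j\<bar> * (3 * \<bar>j\<bar> + 1) \<le> (m - 1) * (3 * (m - 1) + 1)"
      using that by (intro mult_mono) auto
    moreover have "j * (3 * j + 1) \<le> \<bar>j\<bar> * (3 * \<bar>j\<bar> + 1)"
      by (simp add: algebra_simps)
    ultimately show ?thesis
      using two_pent[of j] two_pent[of "- m"] by (simp add: algebra_simps)
  qed
  have "pent (- m) \<le> pent j" if "\<bar>j\<bar> \<ge> m"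
  proof -
    have "m * (3 * m - 1) \<le> \<bar>j\<bar> * (3 * \<bar>j\<bar> - 1)"
      using that assms by (intro mult_mono) auto
    moreover have "\<bar>j\<bar> * (3 * \<bar>j\<bar> - 1) \<le> j * (3 * j + 1)"
      by (simp add: algebra_simps)
    ultimately show ?thesis
      using two_pent[of j] two_pent[of "- m"] by (simp add: algebra_simps)
  qed
  then show "pent j < pent (- m) \<longleftrightarrow> \<bar>j\<bar> < m"
    using gap assms by (smt (verit))
qed

lemma exists_even_card_partitions:
  fixes m :: nat
  assumes "m \<ge> 2"
  shows "\<exists>k\<ge>m. int k < pent (- int m) \<and> even (card (partitions_of k))"
proof (rule ccontr)
  assume "\<not> ?thesis"
  then have odd: "odd (card (partitions_of k))" if "m \<le> k" "int k < pent (- int m)" for k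
    using that by blast
  \<comment> \<open>Just below \<open>pent (- m)\<close> exactly the indices with
    \<open>\<bar>j\<bar> < m\<close> contribute, and their number \<open>2 * m - 1\<close> is
    odd.\<close>
  define n where "n = nat (pent (- int m) - 1)"
  have "int m > 0"
    using assms by simp
  note pent_m = pent_neg_bounds[OF this]
  have n: "int n = pent (- int m) - 1" "n > 0"
    using assms pent_m(2)[of 0] by (auto simp: n_def pent_def[of 0])
  have J: "{j. pent j \<le> int n} = {- int m<..<int m}"
  proof (rule set_eqI)
    fix j
    have "pent j \<le> int n \<longleftrightarrow> pent j < pent (- int m)"
      unfolding n by linarith
    also have "\<dots> \<longleftrightarrow> \<bar>j\<bar> < int m"
      by (rule pent_m(1))
    finally show "j \<in> {j. pent j \<le> int n} \<longleftrightarrow> j \<in> {- int m<..<int m}"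
      by auto
  qed
  have "odd (card (partitions_of (nat (int n - pent j))))" if "j \<in> {- int m<..<int m}" for j
  proof (rule odd)
    have "\<bar>j\<bar> < int m"
      using that by auto
    \<comment> \<open>The gap bound gives \<open>n - pent j \<ge> 2 * m - 2\<close>, which is at
      least \<open>m\<close> since \<open>m \<ge> 2\<close>.\<close>
    then show "m \<le> nat (int n - pent j)"
      using pent_m(2)[of j] assms n(1) by linarith
    show "int (nat (int n - pent j)) < pent (- int m)"
      using pent_nonneg[of j] n by linarith
  qed
  then have "{j \<in> {- int m<..<int m}. odd (card (partitions_of (nat (int n - pent j))))}
      = {- int m<..<int m}"
    by blast
  moreover have "odd (card {- int m<..<int m})"
    using assms by (simp add: nat_diff_distrib' nat_mult_distrib)
  ultimately have "odd (\<Sum>j\<in>{- int m<..<int m}. card (partitions_of (nat (int n - pent j))))"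
    by (simp add: even_sum_iff)
  then show False
    using even_pentagonal_sum[OF n(2)] by (simp add: J)
qed

section \<open>Counting even values on a doubly exponential scale\<close>

text \<open>With \<open>m = 2 ^ 3 ^ i\<close> the even value lies below
  \<open>2 * m\<^sup>2 \<le> m ^ 3\<close>, and cubing \<open>m\<close> raises \<open>i\<close> by
  one.\<close>

lemma exists_even_sigma_moex:
  "\<exists>k\<ge>2 ^ 3 ^ i. k < 2 ^ 3 ^ Suc i \<and> even (sigma_moex k)"
proof -
  define e :: nat where "e = 3 ^ i"
  define m :: nat where "m = 2 ^ e"
  have "e \<ge> 1"
    by (simp add: e_def)
  then have m: "m \<ge> 2"
    unfolding m_def using power_increasing[of 1 e "2::nat"] by simp
  obtain k where k: "k \<ge> m" "int k < pent (- int m)" "even (card (partitions_of k))"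
    using exists_even_card_partitions[OF m] by blast
  have "2 * pent (- int m) \<le> 4 * (int m * int m)"
    unfolding two_pent by (simp add: algebra_simps)
  then have "int k < 2 * (int m * int m)"
    using k(2) by linarith
  then have "int k < int (2 * (m * m))"
    by simp
  then have "k < 2 * (m * m)"
    by (simp only: of_nat_less_iff)
  also have "\<dots> \<le> m * (m * m)"
    using m by (intro mult_right_mono) auto
  also have "\<dots> = 2 ^ 3 ^ Suc i"
    by (simp add: m_def e_def mult.commute flip: power_add)
  finally have "k < 2 ^ 3 ^ Suc i" .
  moreover have "even (sigma_moex k)"
    using k m even_sigma_moex_iff[of k] by simp
  ultimately show ?thesis
    using k(1) by (auto simp: m_def e_def)
qed

lemma card_even_sigma_moex_ge:
  assumes "2 ^ 3 ^ K \<le> X"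
  shows "K \<le> card {n::nat. 1 \<le> n \<and> real n \<le> X \<and> even (sigma_moex n)}"
proof -
  obtain k where k: "\<And>i. 2 ^ 3 ^ i \<le> k i" "\<And>i. k i < 2 ^ 3 ^ Suc i"
    "\<And>i. even (sigma_moex (k i))"
    using exists_even_sigma_moex by metis
  \<comment> \<open>The intervals abut: \<open>k i < 2 ^ 3 ^ Suc i \<le> k (Suc i)\<close>. Hence
    the chosen values are distinct.\<close>
  have "strict_mono k"
    using k(1,2) unfolding strict_mono_Suc_iff by (blast intro: less_le_trans)
  have "k ` {..<K} \<subseteq> {n. 1 \<le> n \<and> real n \<le> X \<and> even (sigma_moex n)}"
  proof clarsimp
    fix i assume "i < K"
    have "k i < 2 ^ 3 ^ Suc i" by (rule k)
    also have "\<dots> \<le> 2 ^ 3 ^ K"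
      using \<open>i < K\<close> by (intro power_increasing) auto
    finally have "real (k i) < real (2 ^ 3 ^ K)"
      by (simp only: of_nat_less_iff)
    then have "real (k i) \<le> X"
      using assms unfolding of_nat_power of_nat_numeral by linarith
    moreover have "0 < k i"
      using k(1)[of i] less_le_trans[of 0 "2 ^ 3 ^ i" "k i"] by simp
    ultimately show "Suc 0 \<le> k i \<and> real (k i) \<le> X \<and> even (sigma_moex (k i))"
      using k(3) by simp
  qed
  moreover have "finite {n. 1 \<le> n \<and> real n \<le> X \<and> even (sigma_moex n)}"
    by (rule finite_subset[of _ "{..nat \<lfloor>X\<rfloor>}"]) (auto simp: le_nat_floor)
  ultimately have "card (k ` {..<K}) \<le> card {n. 1 \<le> n \<and> real n \<le> X \<and> even (sigma_moex n)}"
    by (rule card_mono[rotated])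
  then show ?thesis
    using card_image[of k "{..<K}"] strict_mono_imp_inj_on[OF \<open>strict_mono k\<close>]
    by (simp add: inj_on_subset)
qed

lemma exists_double_power_bracket:
  fixes X :: real
  assumes "X \<ge> 8"
  shows "\<exists>K\<ge>1. 2 ^ 3 ^ K \<le> X \<and> X < 2 ^ 3 ^ Suc K"
proof -
  obtain N where N: "X < 2 ^ N"
    using real_arch_pow[of 2 X] by auto
  have "(2::real) ^ N \<le> 2 ^ 3 ^ N"
    using power_gt_expt[of 3 N] by (intro power_increasing) auto
  with N have ex: "X < 2 ^ 3 ^ N"
    by linarith
  define L where "L = (LEAST L. X < 2 ^ 3 ^ L)"
  have L: "X < 2 ^ 3 ^ L"
    unfolding L_def using ex by (rule LeastI)
  \<comment> \<open>The threshold 8 is \<open>2 ^ 3 ^ 1\<close>; it guarantees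
    \<open>K \<ge> 1\<close>.\<close>
  have "L \<noteq> 0" "L \<noteq> 1"
    using L assms by (auto intro!: Nat.gr0I)
  then obtain K where K: "L = Suc K" "K \<ge> 1"
    by (cases L) auto
  have "\<not> X < 2 ^ 3 ^ K"
    using K(1) not_less_Least[of K "\<lambda>L. X < 2 ^ 3 ^ L"] by (simp add: L_def)
  then show ?thesis
    using K L by (intro exI[of _ K]) auto
qed

theorem theorem1p4:
  shows "\<exists>\<alpha>::real. \<alpha> > 0 \<and>
    (\<forall>\<^sub>F X::real in at_top.
      real (card {n::nat. 1 \<le> n \<and> real n \<le> X \<and> even (sigma_moex n)}) \<ge> \<alpha> * ln (ln X))"
proof (intro exI conjI)
  \<comment> \<open>The constant comes from
    \<open>ln (ln X) \<le> (K + 1) * ln 3 \<le> 2 * (K + 1) \<le> 4 * K\<close>, the last step using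
    \<open>K \<ge> 1\<close>.\<close>
  show "(1 / 4 :: real) > 0" by simp
  show "\<forall>\<^sub>F X::real in at_top.
      real (card {n::nat. 1 \<le> n \<and> real n \<le> X \<and> even (sigma_moex n)}) \<ge> 1 / 4 * ln (ln X)"
    using eventually_ge_at_top[of "8::real"]
  proof eventually_elim
    case (elim X)
    obtain K where K: "K \<ge> 1" "2 ^ 3 ^ K \<le> X" "X < 2 ^ 3 ^ Suc K"
      using exists_double_power_bracket[OF elim] by blast
    have "ln X \<le> ln (2 ^ 3 ^ Suc K)"
      using K(3) elim by (subst ln_le_cancel_iff) auto
    also have "\<dots> = 3 ^ Suc K * ln 2"
      by (simp add: ln_realpow)
    also have "\<dots> \<le> 3 ^ Suc K"
      using ln_le_minus_one[of 2] by simp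
    finally have "ln (ln X) \<le> ln (3 ^ Suc K)"
      using elim by (subst ln_le_cancel_iff) auto
    also have "\<dots> = real (Suc K) * ln 3"
      by (rule ln_realpow)
    also have "\<dots> \<le> real (Suc K) * 2"
      using ln_le_minus_one[of 3] by (intro mult_left_mono) auto
    also have "\<dots> \<le> 4 * real K"
      using K(1) by simp
    finally have "1 / 4 * ln (ln X) \<le> real K"
      by simp
    then show ?case
      using card_even_sigma_moex_ge[OF K(2)] by linarith
  qed
qed

end
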